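(* Let $\mathcal{X}$ be an infinite-dimensional real Banach space, let $G=G_{\mathbb{H}}$ be the quaternion group, and let $\pi$ be a representation of $G$ by linear operators on a dense linear subspace $\mathcal{E}\subset\mathcal{X}$ such that $\pi(1)=-\pi(-1)=\mathbf{1}_{\mathcal{E}}$. If $\pi$ is closed and regular, then $$\mathcal{A}_\pi=\{T\in\mathcal{B}(\mathcal{X}): T\mathcal{E}\subseteq\mathcal{E}\text{ and }T\pi(g)|_{\mathcal{E}}=\pi(g)T|_{\mathcal{E}}\text{ for all }g\in G\}$$ is a Lomonosov algebra of quaternion type on $\mathcal{X}$.
   Context: $G_{\mathbb{H}}=\{\pm1,\pm i,\pm j,\pm k\}\subset\mathbb{H}$ is the quaternion group: $(-1)^2=1$, $i^2=j^2=k^2=-1$, $ijk=-1$. Let $\pi$ be a representation of a finite group $G$ with unit $e_G$ by linear operators (not assumed bounded) on a dense linear subspace $\mathcal{E}$ of $\mathcal{X}$. $\pi$ is closed if, whenever $(x_n)$ is a sequence in $\mathcal{E}$ such that $\pi(g)x_n\to w(g)\in\mathcal{X}$ for all $g\in G$, there is $x\in\mathcal{E}$ with $w(g)=\pi(g)x$ for all $g\in G$. Put $\mathcal{E}^*=\{f\in\mathcal{X}^*: \text{there is } C>0 \text{ with } |f(\pi(g)x)|\le C\|x\| \text{ for all } x\in\mathcal{E}, g\in G\}$; $\pi$ is regular if $\mathcal{E}^*$ is weak*-dense in $\mathcal{X}^*$. $\mathcal{B}(\mathcal{X})$ is the algebra of all bounded linear operators on $\mathcal{X}$; SOT is the strong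 operator topology. A subalgebra of $\mathcal{B}(\mathcal{X})$ is transitive if it has no non-trivial closed invariant subspaces. A Lomonosov algebra is an SOT-closed transitive subalgebra of $\mathcal{B}(\mathcal{X})$ containing a non-zero compact operator; an $L$-algebra is a transitive subalgebra containing a non-zero finite rank operator. (Lomonosov algebras are exactly the SOT-closed $L$-algebras.) For an $L$-algebra $\mathcal{A}$, $\mathcal{A}^F$ is the set of all finite rank operators in $\mathcal{A}$, $\mathcal{X}^F=\mathrm{lin}\{Tx: T\in\mathcal{A}^F, x\in\mathcal{X}\}$, and $\mathbb{D}$ is the algebra of all linear operators $\mathcal{X}^F\to\mathcal{X}^F$ (not assumed bounded) commuting with the restrictions to $\mathcal{X}^F$ of all operators in $\mathcal{A}^F$; $\mathbb{D}$ is always isomorphic to $\mathbb{R}$, $\mathbb{C}$ or the quaternions $\mathbb{H}$, and $\mathcal{A}$ is said to be of real, complex or quaternion type, respectively. *)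

theory Defs
  imports "HOL-Analysis.Analysis" "HOL-Algebra.Group"
begin

section \<open>Quaternions and the quaternion group\<close>

datatype quat = Quat (qRe: real) (qI: real) (qJ: real) (qK: real)

lemma quat_eq_iff:
  "p = q \<longleftrightarrow> qRe p = qRe q \<and> qI p = qI q \<and> qJ p = qJ q \<and> qK p = qK q"
  by (cases p; cases q) simp

instantiation quat :: real_algebra_1
begin

definition "0 = Quat 0 0 0 0"
definition "1 = Quat 1 0 0 0"
definition "p + q = Quat (qRe p + qRe q) (qI p + qI q) (qJ p + qJ q) (qK p + qK q)"
definition "p - q = Quat (qRe p - qRe q) (qI p - qI q) (qJ p - qJ q) (qK p - qK q)"
definition "- p = Quat (- qRe p) (- qI p) (- qJ p) (- qK p)"
definition "p * q = Quat
  (qRe p * qRe q - qI p * qI q - qJ p * qJ q - qK p * qK q)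
  (qRe p * qI q + qI p * qRe q + qJ p * qK q - qK p * qJ q)
  (qRe p * qJ q - qI p * qK q + qJ p * qRe q + qK p * qI q)
  (qRe p * qK q + qI p * qJ q - qJ p * qI q + qK p * qRe q)"
definition "c *\<^sub>R p = Quat (c * qRe p) (c * qI p) (c * qJ p) (c * qK p)"

lemmas quat_defs = zero_quat_def one_quat_def plus_quat_def minus_quat_def
  uminus_quat_def times_quat_def scaleR_quat_def

instance
  by standard (simp_all add: quat_defs algebra_simps)

end

definition quat_i :: quat where "quat_i = Quat 0 1 0 0"
definition quat_j :: quat where "quat_j = Quat 0 0 1 0"
definition quat_k :: quat where "quat_k = Quat 0 0 0 1"

lemma quat_table:
  "quat_i * quat_i = -1" "quat_j * quat_j = -1" "quat_k * quat_k = -1"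
  "quat_i * quat_j = quat_k" "quat_j * quat_k = quat_i" "quat_k * quat_i = quat_j"
  "quat_j * quat_i = - quat_k" "quat_k * quat_j = - quat_i" "quat_i * quat_k = - quat_j"
  by (simp_all add: quat_defs quat_i_def quat_j_def quat_k_def)

lemma quat_ijk: "quat_i * quat_j * quat_k = -1"
  by (simp add: quat_table)

definition quat_group :: "quat monoid" where
  "quat_group =
    \<lparr>carrier = {1, -1, quat_i, - quat_i, quat_j, - quat_j, quat_k, - quat_k},
     mult = (*), one = 1\<rparr>"

lemma group_quat_group: "group quat_group"
proof (rule groupI)
  show "x \<otimes>\<^bsub>quat_group\<^esub> y \<in> carrier quat_group"
    if "x \<in> carrier quat_group" "y \<in> carrier quat_group" for x y
    using that by (simp add: quat_group_def) (elim disjE; simp add: quat_table)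
  show "\<exists>y\<in>carrier quat_group. y \<otimes>\<^bsub>quat_group\<^esub> x = \<one>\<^bsub>quat_group\<^esub>"
    if "x \<in> carrier quat_group" for x
    using that by (simp add: quat_group_def) (elim disjE; simp add: quat_table)
qed (simp_all add: quat_group_def mult.assoc)


section \<open>Representations on a dense subspace\<close>

text \<open>Linear maps between linear subspaces are total functions of which only the values
  on the source subspace matter.\<close>

definition linear_map_on ::
  "'a::real_vector set \<Rightarrow> 'b::real_vector set \<Rightarrow> ('a \<Rightarrow> 'b) \<Rightarrow> bool" where
  "linear_map_on V W S \<longleftrightarrow> S \<in> V \<rightarrow> W \<and>
     (\<forall>x\<in>V. \<forall>y\<in>V. S (x + y) = S x + S y) \<and> (\<forall>c. \<forall>x\<in>V. S (c *\<^sub>R x) = c *\<^sub>R S x)"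

definition representation_on ::
  "('g, 'm) monoid_scheme \<Rightarrow> 'a::real_normed_vector set \<Rightarrow> ('g \<Rightarrow> 'a \<Rightarrow> 'a) \<Rightarrow> bool" where
  "representation_on G E \<pi> \<longleftrightarrow>
     group G \<and> finite (carrier G) \<and> subspace E \<and> closure E = UNIV \<and>
     (\<forall>g\<in>carrier G. linear_map_on E E (\<pi> g)) \<and>
     (\<forall>x\<in>E. \<pi> \<one>\<^bsub>G\<^esub> x = x) \<and>
     (\<forall>g\<in>carrier G. \<forall>h\<in>carrier G. \<forall>x\<in>E. \<pi> (g \<otimes>\<^bsub>G\<^esub> h) x = \<pi> g (\<pi> h x))"

definition closed_representation ::
  "('g, 'm) monoid_scheme \<Rightarrow> 'a::real_normed_vector set \<Rightarrow> ('g \<Rightarrow> 'a \<Rightarrow> 'a) \<Rightarrow> bool" where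
  "closed_representation G E \<pi> \<longleftrightarrow>
     (\<forall>(x :: nat \<Rightarrow> 'a) w. range x \<subseteq> E \<longrightarrow> (\<forall>g\<in>carrier G. (\<lambda>n. \<pi> g (x n)) \<longlonglongrightarrow> w g) \<longrightarrow>
        (\<exists>z\<in>E. \<forall>g\<in>carrier G. w g = \<pi> g z))"

definition rep_dual ::
  "('g, 'm) monoid_scheme \<Rightarrow> 'a::real_normed_vector set \<Rightarrow> ('g \<Rightarrow> 'a \<Rightarrow> 'a) \<Rightarrow>
     ('a \<Rightarrow>\<^sub>L real) set" where
  "rep_dual G E \<pi> =
     {f. \<exists>C>0. \<forall>x\<in>E. \<forall>g\<in>carrier G. \<bar>blinfun_apply f (\<pi> g x)\<bar> \<le> C * norm x}"

text \<open>The topology of pointwise convergence on the dual space.\<close>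

definition weak_star_topology :: "('a::real_normed_vector \<Rightarrow>\<^sub>L real) topology" where
  "weak_star_topology = pullback_topology UNIV blinfun_apply euclidean"

definition regular_representation ::
  "('g, 'm) monoid_scheme \<Rightarrow> 'a::real_normed_vector set \<Rightarrow> ('g \<Rightarrow> 'a \<Rightarrow> 'a) \<Rightarrow> bool" where
  "regular_representation G E \<pi> \<longleftrightarrow> weak_star_topology closure_of rep_dual G E \<pi> = UNIV"

definition rep_algebra ::
  "('g, 'm) monoid_scheme \<Rightarrow> 'a::real_normed_vector set \<Rightarrow> ('g \<Rightarrow> 'a \<Rightarrow> 'a) \<Rightarrow>
     ('a \<Rightarrow>\<^sub>L 'a) set" where
  "rep_algebra G E \<pi> =
     {T. blinfun_apply T ` E \<subseteq> E \<and>
         (\<forall>g\<in>carrier G. \<forall>x\<in>E. blinfun_apply T (\<pi> g x) = \<pi> g (blinfun_apply T x))}"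


section \<open>Operator algebras\<close>

definition finite_dimensional_set :: "'a::real_vector set \<Rightarrow> bool" where
  "finite_dimensional_set S \<longleftrightarrow> (\<exists>B. finite B \<and> S \<subseteq> span B)"

definition finite_rank_op :: "('a::real_normed_vector \<Rightarrow>\<^sub>L 'b::real_normed_vector) \<Rightarrow> bool" where
  "finite_rank_op T \<longleftrightarrow> finite_dimensional_set (range (blinfun_apply T))"

definition compact_op :: "('a::real_normed_vector \<Rightarrow>\<^sub>L 'b::real_normed_vector) \<Rightarrow> bool" where
  "compact_op T \<longleftrightarrow> compact (closure (blinfun_apply T ` cball 0 1))"

text \<open>Subalgebras are not required to contain the identity operator.\<close>

definition operator_subalgebra :: "('a::real_normed_vector \<Rightarrow>\<^sub>L 'a) set \<Rightarrow> bool" where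
  "operator_subalgebra A \<longleftrightarrow> subspace A \<and> (\<forall>S\<in>A. \<forall>T\<in>A. S o\<^sub>L T \<in> A)"

definition transitive_algebra :: "('a::real_normed_vector \<Rightarrow>\<^sub>L 'a) set \<Rightarrow> bool" where
  "transitive_algebra A \<longleftrightarrow> operator_subalgebra A \<and>
     (\<forall>M. subspace M \<longrightarrow> closed M \<longrightarrow> (\<forall>T\<in>A. blinfun_apply T ` M \<subseteq> M) \<longrightarrow> M = {0} \<or> M = UNIV)"

definition Lomonosov_algebra :: "('a::real_normed_vector \<Rightarrow>\<^sub>L 'a) set \<Rightarrow> bool" where
  "Lomonosov_algebra A \<longleftrightarrow> transitive_algebra A \<and> closedin strong_operator_topology A \<and>
     (\<exists>T\<in>A. T \<noteq> 0 \<and> compact_op T)"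

definition L_algebra :: "('a::real_normed_vector \<Rightarrow>\<^sub>L 'a) set \<Rightarrow> bool" where
  "L_algebra A \<longleftrightarrow> transitive_algebra A \<and> (\<exists>T\<in>A. T \<noteq> 0 \<and> finite_rank_op T)"

definition finite_rank_part ::
  "('a::real_normed_vector \<Rightarrow>\<^sub>L 'a) set \<Rightarrow> ('a \<Rightarrow>\<^sub>L 'a) set" where
  "finite_rank_part A = {T \<in> A. finite_rank_op T}"

definition finite_rank_space :: "('a::real_normed_vector \<Rightarrow>\<^sub>L 'a) set \<Rightarrow> 'a set" where
  "finite_rank_space A = span {blinfun_apply T x | T x. T \<in> finite_rank_part A}"

text \<open>Operators on the space \<open>finite_rank_space A\<close> are represented by extensional functions,
  so that distinct members of the following set are distinct operators on that space.\<close>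

definition commutant_algebra :: "('a::real_normed_vector \<Rightarrow>\<^sub>L 'a) set \<Rightarrow> ('a \<Rightarrow> 'a) set" where
  "commutant_algebra A =
     {S \<in> extensional (finite_rank_space A).
        linear_map_on (finite_rank_space A) (finite_rank_space A) S \<and>
        (\<forall>T\<in>finite_rank_part A. \<forall>x\<in>finite_rank_space A.
           S (blinfun_apply T x) = blinfun_apply T (S x))}"

text \<open>The second conjunct says that \<open>commutant_algebra A\<close>, with pointwise linear structure
  and composition as product, is isomorphic to the real algebra of quaternions.\<close>

definition quaternion_type :: "('a::real_normed_vector \<Rightarrow>\<^sub>L 'a) set \<Rightarrow> bool" where
  "quaternion_type A \<longleftrightarrow> L_algebra A \<and>
     (\<exists>\<phi> :: quat \<Rightarrow> 'a \<Rightarrow> 'a.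
        bij_betw \<phi> UNIV (commutant_algebra A) \<and>
        (\<forall>x\<in>finite_rank_space A.
           (\<forall>p q. \<phi> (p + q) x = \<phi> p x + \<phi> q x) \<and>
           (\<forall>c p. \<phi> (c *\<^sub>R p) x = c *\<^sub>R \<phi> p x) \<and>
           (\<forall>p q. \<phi> (p * q) x = \<phi> p (\<phi> q x)) \<and>
           \<phi> 1 x = x))"

end

theory Submission
  imports Defs
begin

text \<open>
  Since \<open>\<pi> (-1) = - 1\<close>, the operators \<open>\<pi> quat_i\<close>, \<open>\<pi> quat_j\<close> and \<open>\<pi> quat_k\<close> turn \<open>E\<close> into a left
  vector space over the quaternions, and \<open>rep_algebra quat_group E \<pi>\<close> consists of the bounded
  operators that preserve \<open>E\<close> and are quaternion-linear there. The whole theorem comes from an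
  abundance of quaternion-linear operators of quaternionic rank one, \<open>x \<mapsto> \<Phi> x \<cdot> y\<close>, where \<open>y \<in> E\<close>
  and \<open>\<Phi>\<close> is a continuous quaternion-valued functional on the whole space that is
  quaternion-linear on \<open>E\<close> (lemma \<open>quaternionic_rank_one_operator\<close>).

  Such functionals exist by regularity. If \<open>f\<close> is in \<open>rep_dual quat_group E \<pi>\<close>, then each
  \<open>f \<circ> \<pi> g\<close> is bounded on \<open>E\<close>, hence extends to the whole space by the Hahn-Banach theorem, and
  \<open>f\<close> together with the extensions for \<open>quat_i, quat_j, quat_k\<close> assembles to a \<open>\<Phi>\<close> with real part
  \<open>f\<close>. Weak-star density and the Hahn-Banach theorem show that for every \<open>m \<noteq> 0\<close> some \<open>\<Phi>\<close> has \<open>\<Phi> m \<noteq> 0\<close>. Because non-zero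
  quaternions are invertible, the operators \<open>x \<mapsto> \<Phi> x \<cdot> y\<close> then carry \<open>m\<close> to every vector
  of the dense subspace \<open>E\<close>, which is transitivity; they are also compact and of finite rank.

  Closedness of \<open>\<pi>\<close> is what makes the algebra closed in the strong operator topology: if
  \<open>T\<^sub>n \<rightarrow> T\<close> at the eight points \<open>\<pi> g x\<close>, then the sequence \<open>T\<^sub>n x\<close> satisfies the premise in the
  definition of closedness.

  For the type, the finite rank operators of the algebra map the whole space into \<open>E\<close>, because the
  image of \<open>E\<close> is finite-dimensional, hence closed, and dense in the range. So the space on which
  the commutant acts is \<open>E\<close>. If \<open>\<Phi> e = 1\<close>, an operator \<open>S\<close> on \<open>E\<close> that commutes with
  \<open>x \<mapsto> \<Phi> x \<cdot> y\<close> satisfies \<open>S y = S (\<Phi> e \<cdot> y) = \<Phi> (S e) \<cdot> y\<close>, so \<open>S\<close> is the action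
  of the quaternion \<open>\<Phi> (S e)\<close>.
\<close>

section \<open>The Hahn-Banach theorem for real normed spaces\<close>

text \<open>
  A linear functional on a subspace is represented by its graph, a subspace of the product with the
  reals. The bound \<open>\<bar>t\<bar> \<le> C * norm x\<close> on the points of the graph forces single-valuedness, since it
  gives \<open>t = 0\<close> over \<open>x = 0\<close>. This lemma adds one vector to the domain.
\<close>

lemma dominated_graph_extension_step:
  fixes \<Gamma> :: "('a::real_normed_vector \<times> real) set"
  assumes sub: "subspace \<Gamma>" and dom: "\<And>x t. (x, t) \<in> \<Gamma> \<Longrightarrow> \<bar>t\<bar> \<le> C * norm x" and "C \<ge> 0"
  obtains \<Delta> where "subspace \<Delta>" "\<Gamma> \<subseteq> \<Delta>" "\<And>x t. (x, t) \<in> \<Delta> \<Longrightarrow> \<bar>t\<bar> \<le> C * norm x"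
    "x\<^sub>0 \<in> fst ` \<Delta>"
proof -
  \<comment> \<open>The value at \<open>x\<^sub>0\<close> has to lie above all numbers on the left and below all numbers on the right of
    \<open>gap\<close>; the supremum of the former does.\<close>
  define a where "a = (SUP (y, s)\<in>\<Gamma>. s - C * norm (y - x\<^sub>0))"
  have gap: "s - C * norm (y - x\<^sub>0) \<le> C * norm (z + x\<^sub>0) - t"
    if "(y, s) \<in> \<Gamma>" "(z, t) \<in> \<Gamma>" for y s z t
  proof -
    have "(y + z, s + t) \<in> \<Gamma>"
      using subspace_add[OF sub that] by simp
    then have "s + t \<le> C * norm (y + z)"
      using dom by fastforce
    also have "\<dots> \<le> C * (norm (y - x\<^sub>0) + norm (z + x\<^sub>0))"
      using norm_triangle_ineq[of "y - x\<^sub>0" "z + x\<^sub>0"] \<open>C \<ge> 0\<close>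
      by (intro mult_left_mono) auto
    finally show ?thesis
      by (simp add: algebra_simps)
  qed
  have zero: "(0, 0) \<in> \<Gamma>"
    using subspace_0[OF sub] by (simp add: zero_prod_def)
  have bdd: "bdd_above ((\<lambda>(y, s). s - C * norm (y - x\<^sub>0)) ` \<Gamma>)"
    using gap[OF _ zero] by (intro bdd_aboveI[where M = "C * norm (0 + x\<^sub>0) - 0"]) auto
  have lower: "s - C * norm (y - x\<^sub>0) \<le> a" if "(y, s) \<in> \<Gamma>" for y s
    unfolding a_def using cSUP_upper[OF that bdd] by simp
  have upper: "a \<le> C * norm (z + x\<^sub>0) - t" if "(z, t) \<in> \<Gamma>" for z t
    unfolding a_def using zero gap[OF _ that] by (intro cSUP_least) auto
  have one_sided: "s + c * a \<le> C * norm (y + c *\<^sub>R x\<^sub>0)" if "(y, s) \<in> \<Gamma>" for y s c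
  proof (cases c "0 :: real" rule: linorder_cases)
    case equal
    then show ?thesis
      using dom[OF that] by simp
  next
    case greater
    have "((1/c) *\<^sub>R y, s / c) \<in> \<Gamma>"
      using subspace_scale[OF sub that, of "1/c"] by simp
    from upper[OF this] have "c * (s / c + a) \<le> c * (C * norm ((1/c) *\<^sub>R y + x\<^sub>0))"
      using greater by (intro mult_left_mono) auto
    also have "\<dots> = C * norm (c *\<^sub>R ((1/c) *\<^sub>R y + x\<^sub>0))"
      unfolding norm_scaleR using greater by simp
    also have "c *\<^sub>R ((1/c) *\<^sub>R y + x\<^sub>0) = y + c *\<^sub>R x\<^sub>0"
      using greater by (simp add: scaleR_add_right)
    finally show ?thesis
      using greater by (simp add: distrib_left)
  next
    case less
    define d where "d = - c"
    then have d: "d > 0"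
      using less by simp
    have "((1/d) *\<^sub>R y, s / d) \<in> \<Gamma>"
      using subspace_scale[OF sub that, of "1/d"] by simp
    from lower[OF this] have "d * (s / d - a) \<le> d * (C * norm ((1/d) *\<^sub>R y - x\<^sub>0))"
      using d by (intro mult_left_mono) auto
    also have "\<dots> = C * norm (d *\<^sub>R ((1/d) *\<^sub>R y - x\<^sub>0))"
      unfolding norm_scaleR using d by simp
    also have "d *\<^sub>R ((1/d) *\<^sub>R y - x\<^sub>0) = y + c *\<^sub>R x\<^sub>0"
      using d by (simp add: scaleR_diff_right d_def)
    finally show ?thesis
      using d by (simp add: right_diff_distrib d_def)
  qed
  have two_sided: "\<bar>s + c * a\<bar> \<le> C * norm (y + c *\<^sub>R x\<^sub>0)" if "(y, s) \<in> \<Gamma>" for y s c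
  proof -
    have "(- y, - s) \<in> \<Gamma>"
      using subspace_neg[OF sub that] by simp
    from one_sided[OF this, of "- c"] have "- (s + c * a) \<le> C * norm (- (y + c *\<^sub>R x\<^sub>0))"
      by simp
    then show ?thesis
      using one_sided[OF that, of c] by (simp only: norm_minus_cancel abs_le_iff)
  qed
  define \<Delta> where "\<Delta> = {p + q | p q. p \<in> \<Gamma> \<and> q \<in> span {(x\<^sub>0, a)}}"
  show ?thesis
  proof
    show "subspace \<Delta>"
      unfolding \<Delta>_def by (rule subspace_sums[OF sub subspace_span])
    show "\<Gamma> \<subseteq> \<Delta>"
    proof
      fix p assume "p \<in> \<Gamma>"
      then have "p + 0 \<in> \<Delta>"
        unfolding \<Delta>_def using span_zero by blast
      then show "p \<in> \<Delta>"
        by simp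
    qed
    show "\<bar>t\<bar> \<le> C * norm x" if "(x, t) \<in> \<Delta>" for x t
      using that two_sided unfolding \<Delta>_def span_singleton by auto
    have "(0, 0) + (x\<^sub>0, a) \<in> \<Delta>"
      unfolding \<Delta>_def using zero span_base[of "(x\<^sub>0, a)" "{(x\<^sub>0, a)}"] by blast
    then show "x\<^sub>0 \<in> fst ` \<Delta>"
      by force
  qed
qed

text \<open>A graph that is maximal for the bound exists by Zorn's lemma, and by the extension step its domain
  is the whole space.\<close>

theorem Hahn_Banach_norm_extension:
  fixes E :: "'a::real_normed_vector set" and f :: "'a \<Rightarrow> real"
  assumes E: "subspace E" and lin: "linear_map_on E UNIV f"
    and bound: "\<And>x. x \<in> E \<Longrightarrow> \<bar>f x\<bar> \<le> C * norm x" and "C \<ge> 0"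
  shows "\<exists>F :: 'a \<Rightarrow>\<^sub>L real. \<forall>x\<in>E. blinfun_apply F x = f x"
proof -
  define \<Gamma>\<^sub>0 where "\<Gamma>\<^sub>0 = (\<lambda>x. (x, f x)) ` E"
  define \<A> where "\<A> = {\<Gamma>. subspace \<Gamma> \<and> \<Gamma>\<^sub>0 \<subseteq> \<Gamma> \<and> (\<forall>x t. (x, t) \<in> \<Gamma> \<longrightarrow> \<bar>t\<bar> \<le> C * norm x)}"
  have f_add: "f (x + y) = f x + f y" if "x \<in> E" "y \<in> E" for x y
    using lin that by (simp add: linear_map_on_def)
  have f_scale: "f (c *\<^sub>R x) = c * f x" if "x \<in> E" for c x
    using lin that by (simp add: linear_map_on_def)
  have "subspace \<Gamma>\<^sub>0"
  proof (rule subspaceI)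
    show "0 \<in> \<Gamma>\<^sub>0"
      unfolding \<Gamma>\<^sub>0_def using subspace_0[OF E] f_scale[OF subspace_0[OF E], of 0]
      by (auto simp: zero_prod_def intro!: image_eqI[where x = 0])
  next
    fix p q assume "p \<in> \<Gamma>\<^sub>0" "q \<in> \<Gamma>\<^sub>0"
    then show "p + q \<in> \<Gamma>\<^sub>0"
      unfolding \<Gamma>\<^sub>0_def using subspace_add[OF E] f_add by force
  next
    fix c p assume "p \<in> \<Gamma>\<^sub>0"
    then show "c *\<^sub>R p \<in> \<Gamma>\<^sub>0"
      unfolding \<Gamma>\<^sub>0_def using subspace_scale[OF E] f_scale by force
  qed
  then have "\<Gamma>\<^sub>0 \<in> \<A>"
    unfolding \<A>_def using bound by (auto simp: \<Gamma>\<^sub>0_def)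
  have union: "\<Union>\<C> \<in> \<A>" if "\<C> \<noteq> {}" and chain: "subset.chain \<A> \<C>" for \<C>
  proof -
    have \<C>: "\<Gamma> \<in> \<A>" if "\<Gamma> \<in> \<C>" for \<Gamma>
      using chain that by (auto simp: subset.chain_def)
    have sub: "subspace \<Gamma>" if "\<Gamma> \<in> \<C>" for \<Gamma>
      using \<C>[OF that] by (simp add: \<A>_def)
    have "subspace (\<Union>\<C>)"
    proof (rule subspaceI)
      show "0 \<in> \<Union>\<C>"
        using \<open>\<C> \<noteq> {}\<close> sub subspace_0 by blast
    next
      fix p q assume "p \<in> \<Union>\<C>" "q \<in> \<Union>\<C>"
      then obtain \<Gamma> \<Delta> where "\<Gamma> \<in> \<C>" "\<Delta> \<in> \<C>" "p \<in> \<Gamma>" "q \<in> \<Delta>"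
        by blast
      moreover from this have "\<Gamma> \<subseteq> \<Delta> \<or> \<Delta> \<subseteq> \<Gamma>"
        using chain by (auto simp: subset_chain_def)
      ultimately show "p + q \<in> \<Union>\<C>"
        using sub subspace_add by (metis UnionI subset_iff)
    next
      fix c p assume "p \<in> \<Union>\<C>"
      then show "c *\<^sub>R p \<in> \<Union>\<C>"
        using sub subspace_scale by blast
    qed
    moreover have "\<Gamma>\<^sub>0 \<subseteq> \<Union>\<C>"
      using \<open>\<C> \<noteq> {}\<close> \<C> by (auto simp: \<A>_def)
    moreover have "\<bar>t\<bar> \<le> C * norm x" if "(x, t) \<in> \<Union>\<C>" for x t
      using that \<C> by (auto simp: \<A>_def)
    ultimately show ?thesis
      by (simp add: \<A>_def)
  qed
  obtain \<Gamma> where "\<Gamma> \<in> \<A>" and maximal: "\<And>\<Delta>. \<Delta> \<in> \<A> \<Longrightarrow> \<Gamma> \<subseteq> \<Delta> \<Longrightarrow> \<Delta> = \<Gamma>"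
    using subset_Zorn_nonempty[of \<A>] \<open>\<Gamma>\<^sub>0 \<in> \<A>\<close> union by blast
  then have sub: "subspace \<Gamma>" and ext: "\<Gamma>\<^sub>0 \<subseteq> \<Gamma>"
    and dom: "\<And>x t. (x, t) \<in> \<Gamma> \<Longrightarrow> \<bar>t\<bar> \<le> C * norm x"
    by (auto simp: \<A>_def)
  have total: "\<exists>t. (x, t) \<in> \<Gamma>" for x
  proof -
    obtain \<Delta> where \<Delta>: "subspace \<Delta>" "\<Gamma> \<subseteq> \<Delta>" "\<And>y t. (y, t) \<in> \<Delta> \<Longrightarrow> \<bar>t\<bar> \<le> C * norm y"
      "x \<in> fst ` \<Delta>"
      using dominated_graph_extension_step[OF sub dom \<open>C \<ge> 0\<close>] by metis
    then have "\<Delta> \<in> \<A>"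
      using ext by (auto simp: \<A>_def)
    then have "\<Delta> = \<Gamma>"
      using maximal \<Delta>(2) by blast
    then show ?thesis
      using \<Delta>(4) by force
  qed
  have unique: "s = t" if "(x, s) \<in> \<Gamma>" "(x, t) \<in> \<Gamma>" for x s t
    using dom[of 0 "s - t"] subspace_diff[OF sub that] by simp
  define F where "F x = (THE t. (x, t) \<in> \<Gamma>)" for x
  have F_graph: "(x, F x) \<in> \<Gamma>" for x
    unfolding F_def using total[of x] unique by (metis theI)
  have F_eq: "F x = t" if "(x, t) \<in> \<Gamma>" for x t
    using unique F_graph that by blast
  have "bounded_linear F"
  proof (rule bounded_linear_intro[where K = C])
    show "F (x + y) = F x + F y" for x y
      using subspace_add[OF sub F_graph F_graph] by (intro F_eq) simp
    show "F (c *\<^sub>R x) = c *\<^sub>R F x" for c x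
      using subspace_scale[OF sub F_graph] by (intro F_eq) simp
    show "norm (F x) \<le> norm x * C" for x
      using dom[OF F_graph] by (simp add: mult.commute)
  qed
  moreover have "F x = f x" if "x \<in> E" for x
    using ext that by (intro F_eq) (auto simp: \<Gamma>\<^sub>0_def)
  ultimately show ?thesis
    by (intro exI[where x = "Blinfun F"]) (simp add: bounded_linear_Blinfun_apply)
qed

text \<open>The coordinate functional on the line through \<open>m\<close> has an extension to the whole space.\<close>

corollary functional_nonzero_at:
  fixes m :: "'a::real_normed_vector"
  assumes "m \<noteq> 0"
  obtains F :: "'a \<Rightarrow>\<^sub>L real" where "blinfun_apply F m \<noteq> 0"
proof -
  define f where "f x = (THE c. x = c *\<^sub>R m)" for x
  have f: "f (c *\<^sub>R m) = c" for c
    unfolding f_def using assms by auto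
  have "linear_map_on (span {m}) UNIV f"
    unfolding linear_map_on_def span_singleton
    by (auto simp: f simp flip: scaleR_add_left)
  moreover have "\<bar>f x\<bar> \<le> (1 / norm m) * norm x" if "x \<in> span {m}" for x
    using that assms by (auto simp: span_singleton f)
  ultimately obtain F :: "'a \<Rightarrow>\<^sub>L real" where "\<forall>x\<in>span {m}. blinfun_apply F x = f x"
    using Hahn_Banach_norm_extension[OF subspace_span, of "{m}" f "1 / norm m"] by auto
  then have "blinfun_apply F m = f m"
    by (simp add: span_base)
  then show ?thesis
    using that[of F] f[of 1] by simp
qed

section \<open>Finite-dimensional subspaces are closed\<close>

text \<open>
  Since \<open>b\<close> has positive distance \<open>d\<close> from \<open>V\<close>, the coefficient \<open>r\<close> of \<open>w + r *\<^sub>R b\<close> is at most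
  \<open>norm (w + r *\<^sub>R b) / d\<close>. So along a convergent sequence the coefficients of \<open>b\<close> converge, and with
  them the components in \<open>V\<close>.
\<close>

lemma closed_add_line:
  fixes V :: "'a::real_normed_vector set"
  assumes V: "subspace V" "closed V" and b: "b \<notin> V"
  shows "closed {v + c *\<^sub>R b | v c. v \<in> V}"
  unfolding closed_sequential_limits
proof (intro allI impI, elim conjE)
  fix x l assume x: "\<forall>n. x n \<in> {v + c *\<^sub>R b | v c. v \<in> V}" and lim: "x \<longlonglongrightarrow> l"
  have "\<forall>n. \<exists>v c. v \<in> V \<and> x n = v + c *\<^sub>R b"
    using x by blast
  then obtain v c where v: "\<And>n. v n \<in> V" and x_eq: "\<And>n. x n = v n + c n *\<^sub>R b"
    by metis
  define d where "d = infdist b V"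
  have "V \<noteq> {}"
    using subspace_0[OF V(1)] by blast
  then have "d > 0"
    unfolding d_def using b V(2) by (metis in_closed_iff_infdist_zero infdist_nonneg order_le_less)
  have coeff: "\<bar>r\<bar> * d \<le> norm (w + r *\<^sub>R b)" if "w \<in> V" for w r
  proof (cases "r = 0")
    case False
    have "- (1/r) *\<^sub>R w \<in> V"
      using subspace_scale[OF V(1) that] .
    then have "d \<le> dist b (- (1/r) *\<^sub>R w)"
      unfolding d_def by (rule infdist_le)
    then have "\<bar>r\<bar> * d \<le> \<bar>r\<bar> * norm (b + (1/r) *\<^sub>R w)"
      by (intro mult_left_mono) (auto simp: dist_norm)
    also have "\<dots> = norm (r *\<^sub>R (b + (1/r) *\<^sub>R w))"
      by simp
    also have "r *\<^sub>R (b + (1/r) *\<^sub>R w) = w + r *\<^sub>R b"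
      using False by (simp add: scaleR_add_right)
    finally show ?thesis .
  qed simp
  have "Cauchy c"
  proof (rule metric_CauchyI)
    fix e :: real assume "e > 0"
    then obtain N where N: "\<And>m n. m \<ge> N \<Longrightarrow> n \<ge> N \<Longrightarrow> dist (x m) (x n) < e * d"
      using metric_CauchyD[OF LIMSEQ_imp_Cauchy[OF lim], of "e * d"] \<open>d > 0\<close> by auto
    have "dist (c m) (c n) < e" if "m \<ge> N" "n \<ge> N" for m n
    proof -
      have "\<bar>c m - c n\<bar> * d \<le> norm ((v m - v n) + (c m - c n) *\<^sub>R b)"
        by (rule coeff) (intro subspace_diff V v)
      also have "\<dots> = dist (x m) (x n)"
        by (simp add: x_eq dist_norm algebra_simps)
      also have "\<dots> < e * d"
        using N that by blast
      finally show ?thesis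
        using \<open>d > 0\<close> by (simp add: dist_real_def)
    qed
    then show "\<exists>M. \<forall>m\<ge>M. \<forall>n\<ge>M. dist (c m) (c n) < e"
      by blast
  qed
  then obtain r where r: "c \<longlonglongrightarrow> r"
    using Cauchy_convergent convergent_def by blast
  have "(\<lambda>n. x n - c n *\<^sub>R b) \<longlonglongrightarrow> l - r *\<^sub>R b"
    by (intro tendsto_intros lim r)
  then have "v \<longlonglongrightarrow> l - r *\<^sub>R b"
    by (simp add: x_eq)
  then have "l - r *\<^sub>R b \<in> V"
    using V(2) v closed_sequentially by blast
  then show "l \<in> {v + c *\<^sub>R b | v c. v \<in> V}"
    by (auto intro!: exI[where x = "l - r *\<^sub>R b"] exI[where x = r])
qed

lemma closed_span_finite:
  fixes B :: "'a::real_normed_vector set"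
  assumes "finite B"
  shows "closed (span B)"
  using assms
proof (induction B rule: finite_induct)
  case (insert b B)
  show ?case
  proof (cases "b \<in> span B")
    case True
    then show ?thesis
      using insert.IH by (simp add: span_redundant)
  next
    case False
    have "span (insert b B) = {v + c *\<^sub>R b | v c. v \<in> span B}"
    proof (intro equalityI subsetI)
      fix x assume "x \<in> span (insert b B)"
      then obtain k where "x - k *\<^sub>R b \<in> span B"
        by (auto simp: span_insert)
      moreover have "x = (x - k *\<^sub>R b) + k *\<^sub>R b"
        by simp
      ultimately show "x \<in> {v + c *\<^sub>R b | v c. v \<in> span B}"
        by blast
    next
      fix x assume "x \<in> {v + c *\<^sub>R b | v c. v \<in> span B}"
      then obtain v c where "v \<in> span B" "x = v + c *\<^sub>R b"
        by blast
      then have "x - c *\<^sub>R b \<in> span B"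
        by simp
      then show "x \<in> span (insert b B)"
        unfolding span_insert by blast
    qed
    then show ?thesis
      using closed_add_line[OF subspace_span insert.IH False] by simp
  qed
qed simp

lemma closed_finite_dimensional_subspace:
  fixes V :: "'a::real_normed_vector set"
  assumes "subspace V" "finite_dimensional_set V"
  shows "closed V"
proof -
  obtain C where C: "finite C" "V \<subseteq> span C"
    using assms(2) by (auto simp: finite_dimensional_set_def)
  obtain B where B: "B \<subseteq> V" "independent B" "V \<subseteq> span B"
    by (rule maximal_independent_subset)
  then have "finite B"
    using independent_span_bound[OF C(1) B(2)] C(2) by blast
  moreover have "V = span B"
    using B assms(1) span_minimal by blast
  ultimately show ?thesis
    using closed_span_finite by simp
qed

section \<open>Closed sets in the strong operator topology\<close>

text \<open>
  The strong operator topology is not sequential in general, but a neighbourhood constrains finitely many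
  points only. Hence a point of the closure is, on any given finite set, the limit of a sequence.
\<close>

lemma closedin_strong_operator_topologyI:
  assumes "\<And>T. (\<And>P. finite P \<Longrightarrow>
      \<exists>S. (\<forall>n. S n \<in> A) \<and> (\<forall>x\<in>P. (\<lambda>n. blinfun_apply (S n) x) \<longlonglongrightarrow> blinfun_apply T x)) \<Longrightarrow> T \<in> A"
  shows "closedin strong_operator_topology A"
proof -
  have "T \<in> A" if T: "T \<in> strong_operator_topology closure_of A" for T
  proof (rule assms)
    fix P :: "'a set" assume "finite P"
    have "\<exists>S\<in>A. \<forall>x\<in>P. dist (blinfun_apply S x) (blinfun_apply T x) < inverse (real (Suc n))" for n
    proof -
      define U where "U = {S. \<forall>x\<in>P. blinfun_apply S x \<in> ball (blinfun_apply T x) (inverse (real (Suc n)))}"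
      have "openin strong_operator_topology U"
        unfolding U_def by (rule strong_operator_topology_basis) (use \<open>finite P\<close> in auto)
      moreover have "T \<in> U"
        by (simp add: U_def)
      ultimately obtain S where "S \<in> A" "S \<in> U"
        using T unfolding in_closure_of by blast
      then show ?thesis
        by (auto simp: U_def dist_commute)
    qed
    then obtain S where S: "\<And>n. S n \<in> A"
      "\<And>n x. x \<in> P \<Longrightarrow> dist (blinfun_apply (S n) x) (blinfun_apply T x) < inverse (real (Suc n))"
      by metis
    have "(\<lambda>n. blinfun_apply (S n) x) \<longlonglongrightarrow> blinfun_apply T x" if "x \<in> P" for x
      unfolding tendsto_dist_iff[of _ "blinfun_apply T x"]
      by (rule tendsto_sandwich[OF _ _ tendsto_const LIMSEQ_inverse_real_of_nat])
         (auto intro!: always_eventually less_imp_le S(2)[OF that] simp del: of_nat_Suc)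
    then show "\<exists>S. (\<forall>n. S n \<in> A) \<and> (\<forall>x\<in>P. (\<lambda>n. blinfun_apply (S n) x) \<longlonglongrightarrow> blinfun_apply T x)"
      using S(1) by blast
  qed
  then show ?thesis
    by (metis closure_of_subset_eq strong_operator_topology_topspace subsetI subset_UNIV)
qed

section \<open>The quaternionic structure of the representation space\<close>

lemma quat_sel:
  "qRe 0 = 0" "qI 0 = 0" "qJ 0 = 0" "qK 0 = 0"
  "qRe 1 = 1" "qI 1 = 0" "qJ 1 = 0" "qK 1 = 0"
  "qRe (p + q) = qRe p + qRe q" "qI (p + q) = qI p + qI q"
  "qJ (p + q) = qJ p + qJ q" "qK (p + q) = qK p + qK q"
  "qRe (- p) = - qRe p" "qI (- p) = - qI p" "qJ (- p) = - qJ p" "qK (- p) = - qK p"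
  "qRe (c *\<^sub>R p) = c * qRe p" "qI (c *\<^sub>R p) = c * qI p"
  "qJ (c *\<^sub>R p) = c * qJ p" "qK (c *\<^sub>R p) = c * qK p"
  "qRe (p * q) = qRe p * qRe q - qI p * qI q - qJ p * qJ q - qK p * qK q"
  "qI (p * q) = qRe p * qI q + qI p * qRe q + qJ p * qK q - qK p * qJ q"
  "qJ (p * q) = qRe p * qJ q - qI p * qK q + qJ p * qRe q + qK p * qI q"
  "qK (p * q) = qRe p * qK q + qI p * qJ q - qJ p * qI q + qK p * qRe q"
  "qRe quat_i = 0" "qI quat_i = 1" "qJ quat_i = 0" "qK quat_i = 0"
  "qRe quat_j = 0" "qI quat_j = 0" "qJ quat_j = 1" "qK quat_j = 0"
  "qRe quat_k = 0" "qI quat_k = 0" "qJ quat_k = 0" "qK quat_k = 1"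
  by (simp_all add: quat_defs quat_i_def quat_j_def quat_k_def)

lemma quat_inverse:
  assumes "q \<noteq> (0 :: quat)"
  obtains p where "p * q = 1" "q * p = 1"
proof -
  \<comment> \<open>The inverse is the conjugate divided by the squared norm.\<close>
  define n where "n = (qRe q)\<^sup>2 + (qI q)\<^sup>2 + (qJ q)\<^sup>2 + (qK q)\<^sup>2"
  have "n \<noteq> 0"
    using assms by (auto simp: n_def quat_eq_iff quat_sel add_nonneg_eq_0_iff)
  have n: "n = qRe q * qRe q + qI q * qI q + qJ q * qJ q + qK q * qK q"
    by (simp add: n_def power2_eq_square)
  define p where "p = (1 / n) *\<^sub>R Quat (qRe q) (- qI q) (- qJ q) (- qK q)"
  have "p * q = 1" "q * p = 1"
    using \<open>n \<noteq> 0\<close> by (auto simp: p_def quat_sel quat_eq_iff field_simps) (simp_all add: n)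
  then show ?thesis
    using that by blast
qed

lemma quat_group_mult: "g \<otimes>\<^bsub>quat_group\<^esub> h = g * h"
  by (simp add: quat_group_def)

locale quaternionic_representation =
  fixes E :: "'a::real_normed_vector set" and \<pi> :: "quat \<Rightarrow> 'a \<Rightarrow> 'a"
  assumes rep: "representation_on quat_group E \<pi>"
    and neg_one: "x \<in> E \<Longrightarrow> \<pi> (-1) x = - x"
begin

definition act :: "quat \<Rightarrow> 'a \<Rightarrow> 'a" where
  "act q x = qRe q *\<^sub>R x + qI q *\<^sub>R \<pi> quat_i x + qJ q *\<^sub>R \<pi> quat_j x + qK q *\<^sub>R \<pi> quat_k x"

lemma subspace_E: "subspace E" and dense_E: "closure E = UNIV"
  using rep by (simp_all add: representation_on_def)

lemma pi_linear: "g \<in> carrier quat_group \<Longrightarrow> linear_map_on E E (\<pi> g)"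
  using rep by (simp add: representation_on_def)

lemma pi_in: "g \<in> carrier quat_group \<Longrightarrow> x \<in> E \<Longrightarrow> \<pi> g x \<in> E"
  using pi_linear unfolding linear_map_on_def by blast

lemma pi_add: "g \<in> carrier quat_group \<Longrightarrow> x \<in> E \<Longrightarrow> y \<in> E \<Longrightarrow> \<pi> g (x + y) = \<pi> g x + \<pi> g y"
  using pi_linear by (auto simp: linear_map_on_def)

lemma pi_scaleR: "g \<in> carrier quat_group \<Longrightarrow> x \<in> E \<Longrightarrow> \<pi> g (c *\<^sub>R x) = c *\<^sub>R \<pi> g x"
  using pi_linear by (auto simp: linear_map_on_def)

lemma pi_one: "x \<in> E \<Longrightarrow> \<pi> 1 x = x"
  using rep by (simp add: representation_on_def quat_group_def)

lemma pi_mult: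
  "g \<in> carrier quat_group \<Longrightarrow> h \<in> carrier quat_group \<Longrightarrow> x \<in> E \<Longrightarrow> \<pi> g (\<pi> h x) = \<pi> (g * h) x"
  using rep by (simp add: representation_on_def quat_group_mult)

lemma units: "1 \<in> carrier quat_group" "-1 \<in> carrier quat_group" "quat_i \<in> carrier quat_group"
  "quat_j \<in> carrier quat_group" "quat_k \<in> carrier quat_group"
  by (simp_all add: quat_group_def)

lemma pi_uminus:
  assumes "g \<in> carrier quat_group" "x \<in> E"
  shows "\<pi> (- g) x = - \<pi> g x"
  using pi_mult[OF units(2) assms] neg_one[OF pi_in[OF assms]] by simp

lemmas pi_rules = pi_in pi_add pi_scaleR pi_one pi_mult pi_uminus units neg_one quat_table

lemma act_in: "x \<in> E \<Longrightarrow> act q x \<in> E"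
  unfolding act_def by (intro subspace_add subspace_scale subspace_E pi_in units)

lemma act_linear: "linear_map_on E E (act q)"
  unfolding linear_map_on_def using act_in
  by (auto simp: act_def pi_rules subspace_add subspace_scale subspace_E algebra_simps)

lemma act_one: "act 1 x = x"
  by (simp add: act_def quat_sel)

lemma act_add: "act (p + q) x = act p x + act q x"
  by (simp add: act_def quat_sel algebra_simps)

lemma act_scaleR: "act (c *\<^sub>R q) x = c *\<^sub>R act q x"
  by (simp add: act_def quat_sel algebra_simps)

lemma act_mult:
  assumes "x \<in> E"
  shows "act p (act q x) = act (p * q) x"
proof -
  have "act p (act q x) =
      qRe p *\<^sub>R act q x + qI p *\<^sub>R \<pi> quat_i (act q x) + qJ p *\<^sub>R \<pi> quat_j (act q x) + qK p *\<^sub>R \<pi> quat_k (act q x)"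
    by (simp add: act_def[of p])
  also have "\<dots> = act (p * q) x"
    using assms
    by (simp add: act_def pi_rules subspace_add subspace_scale subspace_E quat_sel algebra_simps)
  finally show ?thesis .
qed

lemma pi_eq_act:
  assumes "g \<in> carrier quat_group" "x \<in> E"
  shows "\<pi> g x = act g x"
  using assms(1) unfolding quat_group_def
  by (auto simp: act_def pi_rules assms(2) quat_sel)

text \<open>The quaternion \<open>q\<close> acts as a real linear combination of \<open>\<pi> g\<close> for the units \<open>g\<close>.\<close>

lemma blinfun_commutes_act:
  assumes "T \<in> rep_algebra quat_group E \<pi>" "x \<in> E"
  shows "blinfun_apply T (act q x) = act q (blinfun_apply T x)"
  using assms units by (simp add: act_def rep_algebra_def blinfun.add_right blinfun.scaleR_right)

section \<open>Quaternionic functionals\<close>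

text \<open>The components are real-linear and continuous on the whole space, whereas linearity over the
  quaternions makes sense only on \<open>E\<close>, where the quaternions act.\<close>

definition quat_functional :: "('a \<Rightarrow> quat) \<Rightarrow> bool" where
  "quat_functional \<Phi> \<longleftrightarrow>
     bounded_linear (\<lambda>x. qRe (\<Phi> x)) \<and> bounded_linear (\<lambda>x. qI (\<Phi> x)) \<and>
     bounded_linear (\<lambda>x. qJ (\<Phi> x)) \<and> bounded_linear (\<lambda>x. qK (\<Phi> x)) \<and>
     (\<forall>q. \<forall>x\<in>E. \<Phi> (act q x) = q * \<Phi> x)"

text \<open>
  A quaternion-linear functional is determined by its real part \<open>f\<close>: the \<open>quat_i\<close>-component of \<open>\<Phi> x\<close> is
  the real part of \<open>- quat_i * \<Phi> x = \<Phi> (- quat_i \<cdot> x)\<close>, that is \<open>- f (\<pi> quat_i x)\<close>, and likewise for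
  the other units. On \<open>E\<close> this defines \<open>\<Phi>\<close>, and membership in the dual of the representation
  is what allows the components to be extended.
\<close>

lemma quat_functional_real_part:
  assumes "f \<in> rep_dual quat_group E \<pi>"
  obtains \<Phi> where "quat_functional \<Phi>" "\<forall>x. qRe (\<Phi> x) = blinfun_apply f x"
proof -
  obtain C where "C > 0"
    and C: "\<And>x g. x \<in> E \<Longrightarrow> g \<in> carrier quat_group \<Longrightarrow> \<bar>blinfun_apply f (\<pi> g x)\<bar> \<le> C * norm x"
    using assms by (auto simp: rep_dual_def)
  have "\<exists>F :: 'a \<Rightarrow>\<^sub>L real. \<forall>x\<in>E. blinfun_apply F x = blinfun_apply f (\<pi> g x)"
    if g: "g \<in> carrier quat_group" for g
  proof -
    have "linear_map_on E UNIV (\<lambda>x. blinfun_apply f (\<pi> g x))"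
      using g by (simp add: linear_map_on_def pi_rules blinfun.add_right blinfun.scaleR_right)
    then show ?thesis
      by (rule Hahn_Banach_norm_extension[OF subspace_E _ C[OF _ g] less_imp_le[OF \<open>C > 0\<close>]])
  qed
  then have "\<exists>F :: quat \<Rightarrow> 'a \<Rightarrow>\<^sub>L real. \<forall>g\<in>carrier quat_group. \<forall>x\<in>E.
      blinfun_apply (F g) x = blinfun_apply f (\<pi> g x)"
    by (intro bchoice) blast
  then obtain F :: "quat \<Rightarrow> 'a \<Rightarrow>\<^sub>L real" where
    F: "\<And>g x. g \<in> carrier quat_group \<Longrightarrow> x \<in> E \<Longrightarrow> blinfun_apply (F g) x = blinfun_apply f (\<pi> g x)"
    by blast
  define \<Phi> where "\<Phi> x = Quat (f x) (- F quat_i x) (- F quat_j x) (- F quat_k x)" for x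
  have "\<Phi> (act q x) = q * \<Phi> x" if "x \<in> E" for q x
    using that
    by (simp add: \<Phi>_def F act_in units quat_eq_iff quat_sel)
       (simp add: act_def pi_rules subspace_add subspace_scale subspace_E quat_sel
          blinfun.add_right blinfun.scaleR_right blinfun.minus_right
          blinfun.diff_right algebra_simps)
  then have "quat_functional \<Phi>"
    unfolding quat_functional_def \<Phi>_def
    by (auto intro!: bounded_linear_minus blinfun.bounded_linear_right)
  then show ?thesis
    using that by (simp add: \<Phi>_def)
qed

text \<open>Not vanishing at \<open>m\<close> is a weak-star open condition. It is satisfiable by the Hahn-Banach theorem,
  so it meets the weak-star dense set of functionals that are real parts.\<close>

lemma quat_functional_nonzero_at:
  assumes "regular_representation quat_group E \<pi>" and "m \<noteq> 0"
  obtains \<Phi> where "quat_functional \<Phi>" "\<Phi> m \<noteq> 0"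
proof -
  obtain F :: "'a \<Rightarrow>\<^sub>L real" where "blinfun_apply F m \<noteq> 0"
    using functional_nonzero_at[OF \<open>m \<noteq> 0\<close>] .
  define U where "U = {h :: 'a \<Rightarrow>\<^sub>L real. blinfun_apply h m \<noteq> 0}"
  have "openin weak_star_topology U"
    using strong_operator_topology_basis[of "{m}" "\<lambda>_. - {0 :: real}" "\<lambda>x. x"]
    by (simp add: weak_star_topology_def strong_operator_topology_def open_Compl U_def)
  moreover have "F \<in> weak_star_topology closure_of rep_dual quat_group E \<pi>"
    using assms(1) by (simp add: regular_representation_def)
  moreover have "F \<in> U"
    using \<open>blinfun_apply F m \<noteq> 0\<close> by (simp add: U_def)
  ultimately obtain f where f: "f \<in> rep_dual quat_group E \<pi>" "f \<in> U"
    unfolding in_closure_of by blast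
  obtain \<Phi> where \<Phi>: "quat_functional \<Phi>" "\<forall>x. qRe (\<Phi> x) = blinfun_apply f x"
    using quat_functional_real_part[OF f(1)] .
  have "qRe (\<Phi> m) \<noteq> 0"
    using f(2) \<Phi>(2) by (simp add: U_def)
  then have "\<Phi> m \<noteq> 0"
    by (auto simp: quat_sel)
  with \<Phi>(1) show ?thesis
    by (rule that)
qed

text \<open>
  The operator \<open>x \<mapsto> \<Phi> x \<cdot> y\<close> commutes with the action because scalars stand to the left of \<open>\<Phi> x\<close>
  in \<open>\<Phi> (q \<cdot> x) = q * \<Phi> x\<close>. Its range lies in the real span of \<open>y\<close> and its images under the three
  units, which also gives compactness: the unit ball is mapped into the continuous image of a
  product of four compact sets of real coefficients.
\<close>

lemma quaternionic_rank_one_operator: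
  assumes \<Phi>: "quat_functional \<Phi>" and y: "y \<in> E"
  obtains T where "T \<in> rep_algebra quat_group E \<pi>" "finite_rank_op T" "compact_op T"
    "blinfun_apply T = (\<lambda>x. act (\<Phi> x) y)"
proof -
  note lin = \<Phi>[unfolded quat_functional_def]
  have bl: "bounded_linear (\<lambda>x. act (\<Phi> x) y)"
    unfolding act_def using lin
    by (intro bounded_linear_add bounded_linear_compose[OF bounded_linear_scaleR_left]) auto
  define T where "T = Blinfun (\<lambda>x. act (\<Phi> x) y)"
  have T: "blinfun_apply T x = act (\<Phi> x) y" for x
    using bl by (simp add: T_def bounded_linear_Blinfun_apply)
  have "T \<in> rep_algebra quat_group E \<pi>"
    using lin y by (auto simp: rep_algebra_def T act_in pi_eq_act act_mult)
  moreover have "finite_rank_op T"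
    unfolding finite_rank_op_def finite_dimensional_set_def
  proof (intro exI conjI)
    show "finite {y, \<pi> quat_i y, \<pi> quat_j y, \<pi> quat_k y}"
      by simp
    have "act q y \<in> span {y, \<pi> quat_i y, \<pi> quat_j y, \<pi> quat_k y}" for q
      unfolding act_def by (intro span_add span_scale span_base) auto
    then show "range (blinfun_apply T) \<subseteq> span {y, \<pi> quat_i y, \<pi> quat_j y, \<pi> quat_k y}"
      by (auto simp: T)
  qed
  moreover have "compact_op T"
  proof -
    define D where "D h = closure (h ` cball 0 1)" for h :: "'a \<Rightarrow> real"
    have D: "compact (D h)" if "bounded_linear h" for h
      unfolding D_def compact_closure using that by (intro bounded_linear_image) auto
    have D_mem: "h x \<in> D h" if "norm x \<le> 1" for h x
      unfolding D_def using that by (intro subsetD[OF closure_subset] imageI) simp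
    let ?comb = "\<lambda>(a, b, c, d). a *\<^sub>R y + b *\<^sub>R \<pi> quat_i y + c *\<^sub>R \<pi> quat_j y + d *\<^sub>R \<pi> quat_k y"
    let ?box = "D (\<lambda>x. qRe (\<Phi> x)) \<times> D (\<lambda>x. qI (\<Phi> x)) \<times> D (\<lambda>x. qJ (\<Phi> x)) \<times> D (\<lambda>x. qK (\<Phi> x))"
    have comb: "compact (?comb ` ?box)"
      using lin by (intro compact_continuous_image compact_Times D)
        (auto simp: case_prod_unfold intro!: continuous_intros)
    have "blinfun_apply T ` cball 0 1 \<subseteq> ?comb ` ?box"
    proof
      fix z assume "z \<in> blinfun_apply T ` cball 0 1"
      then obtain x where x: "norm x \<le> 1" "z = act (\<Phi> x) y"
        by (auto simp: T)
      then show "z \<in> ?comb ` ?box"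
        by (intro image_eqI[where x = "(qRe (\<Phi> x), qI (\<Phi> x), qJ (\<Phi> x), qK (\<Phi> x))"])
           (auto simp: act_def intro: D_mem)
    qed
    then have "closure (blinfun_apply T ` cball 0 1) \<subseteq> ?comb ` ?box"
      by (rule closure_minimal[OF _ compact_imp_closed[OF comb]])
    then show ?thesis
      unfolding compact_op_def using compact_Int_closed[OF comb closed_closure]
      by (metis inf.absorb2)
  qed
  ultimately show ?thesis
    using that T by (simp add: fun_eq_iff)
qed

section \<open>The algebra is a Lomonosov algebra\<close>

lemma rep_algebra_subalgebra: "operator_subalgebra (rep_algebra quat_group E \<pi>)"
  unfolding operator_subalgebra_def rep_algebra_def
  by (auto intro!: subspaceI simp: blinfun.add_left blinfun.scaleR_left image_subset_iff
      subspace_add subspace_scale subspace_0 subspace_E pi_add pi_scaleR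
      pi_scaleR[OF _ subspace_0[OF subspace_E], of _ 0, simplified])

text \<open>
  For \<open>x \<in> E\<close>, approximate \<open>T\<close> on the finite orbit of \<open>x\<close> by a sequence \<open>S\<close> in the algebra.
  Since \<open>\<pi> g (S n x) = S n (\<pi> g x)\<close> converges to \<open>T (\<pi> g x)\<close> for every \<open>g\<close>, closedness yields
  \<open>z \<in> E\<close> with \<open>T (\<pi> g x) = \<pi> g z\<close>, and \<open>g = 1\<close> identifies \<open>z\<close> as \<open>T x\<close>.
\<close>

lemma rep_algebra_SOT_closed:
  assumes "closed_representation quat_group E \<pi>"
  shows "closedin strong_operator_topology (rep_algebra quat_group E \<pi>)"
proof (rule closedin_strong_operator_topologyI)
  fix T assume approx: "\<And>P. finite P \<Longrightarrow> \<exists>S. (\<forall>n. S n \<in> rep_algebra quat_group E \<pi>) \<and>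
      (\<forall>x\<in>P. (\<lambda>n. blinfun_apply (S n) x) \<longlonglongrightarrow> blinfun_apply T x)"
  have "\<exists>z\<in>E. \<forall>g\<in>carrier quat_group. blinfun_apply T (\<pi> g x) = \<pi> g z" if "x \<in> E" for x
  proof -
    have "finite ((\<lambda>g. \<pi> g x) ` carrier quat_group)"
      by (simp add: quat_group_def)
    from approx[OF this] obtain S where S: "\<And>n. S n \<in> rep_algebra quat_group E \<pi>"
      and lim: "\<And>g. g \<in> carrier quat_group \<Longrightarrow>
        (\<lambda>n. blinfun_apply (S n) (\<pi> g x)) \<longlonglongrightarrow> blinfun_apply T (\<pi> g x)"
      by auto
    have "range (\<lambda>n. blinfun_apply (S n) x) \<subseteq> E"
      using S \<open>x \<in> E\<close> by (auto simp: rep_algebra_def)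
    moreover have "(\<lambda>n. \<pi> g (blinfun_apply (S n) x)) \<longlonglongrightarrow> blinfun_apply T (\<pi> g x)"
      if "g \<in> carrier quat_group" for g
      using lim[OF that] S \<open>x \<in> E\<close> that by (simp add: rep_algebra_def)
    ultimately show ?thesis
      using assms[unfolded closed_representation_def, rule_format,
          of "\<lambda>n. blinfun_apply (S n) x" "\<lambda>g. blinfun_apply T (\<pi> g x)"] by blast
  qed
  then have "blinfun_apply T x \<in> E \<and>
      (\<forall>g\<in>carrier quat_group. blinfun_apply T (\<pi> g x) = \<pi> g (blinfun_apply T x))"
    if "x \<in> E" for x
    using that units(1) pi_one by metis
  then show "T \<in> rep_algebra quat_group E \<pi>"
    by (auto simp: rep_algebra_def)
qed

text \<open>
  If \<open>\<Phi> m\<close> is invertible with inverse \<open>p\<close>, the operator \<open>x \<mapsto> \<Phi> x \<cdot> (p \<cdot> z)\<close> takes \<open>m\<close> to \<open>z\<close>.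
  So an invariant subspace that contains \<open>m\<close> contains all of \<open>E\<close>.
\<close>

lemma rep_algebra_transitive:
  assumes "regular_representation quat_group E \<pi>"
  shows "transitive_algebra (rep_algebra quat_group E \<pi>)"
  unfolding transitive_algebra_def
proof (intro conjI rep_algebra_subalgebra allI impI)
  fix M :: "'a set"
  assume M: "subspace M" "closed M" "\<forall>T\<in>rep_algebra quat_group E \<pi>. blinfun_apply T ` M \<subseteq> M"
  show "M = {0} \<or> M = UNIV"
  proof (cases "M = {0}")
    case False
    then obtain m where m: "m \<in> M" "m \<noteq> 0"
      using subspace_0[OF M(1)] by blast
    obtain \<Phi> where \<Phi>: "quat_functional \<Phi>" "\<Phi> m \<noteq> 0"
      using quat_functional_nonzero_at[OF assms m(2)] .
    obtain p where p: "\<Phi> m * p = 1"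
      using quat_inverse[OF \<Phi>(2)] by blast
    have "z \<in> M" if z: "z \<in> E" for z
    proof -
      obtain T where T: "T \<in> rep_algebra quat_group E \<pi>" "finite_rank_op T" "compact_op T"
        "blinfun_apply T = (\<lambda>x. act (\<Phi> x) (act p z))"
        by (rule quaternionic_rank_one_operator[OF \<Phi>(1) act_in[OF z]])
      have "blinfun_apply T m = z"
        using z p by (simp add: T(4) act_mult act_one)
      then show ?thesis
        using M(3) T(1) m(1) by blast
    qed
    then have "closure E \<subseteq> M"
      using M(2) by (intro closure_minimal) auto
    then show ?thesis
      using dense_E by auto
  qed simp
qed

section \<open>The commutant is the algebra of quaternions\<close>

lemma E_nonzero:
  assumes "\<not> finite_dimensional_set (UNIV :: 'a set)"
  obtains m where "m \<in> E" "m \<noteq> 0"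
proof -
  have "E \<noteq> {0}"
  proof
    assume "E = {0}"
    then have "(UNIV :: 'a set) \<subseteq> span {}"
      using dense_E by simp
    then show False
      using assms finite_dimensional_set_def by blast
  qed
  then show ?thesis
    using that subspace_0[OF subspace_E] by blast
qed

text \<open>By left linearity, replacing \<open>m\<close> by \<open>p \<cdot> m\<close> with \<open>p\<close> inverse to \<open>\<Phi> m\<close> makes the value equal to \<open>1\<close>.\<close>

lemma normalized_functional:
  assumes "regular_representation quat_group E \<pi>" and "m \<in> E" "m \<noteq> 0"
  obtains \<Phi> e where "quat_functional \<Phi>" "e \<in> E" "\<Phi> e = 1"
proof -
  obtain \<Phi> where \<Phi>: "quat_functional \<Phi>" "\<Phi> m \<noteq> 0"
    using quat_functional_nonzero_at[OF assms(1,3)] .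
  obtain p where "p * \<Phi> m = 1"
    using quat_inverse[OF \<Phi>(2)] by blast
  then have "\<Phi> (act p m) = 1"
    using \<Phi>(1) \<open>m \<in> E\<close> by (simp add: quat_functional_def)
  then show ?thesis
    using that \<Phi>(1) act_in[OF \<open>m \<in> E\<close>] by blast
qed

text \<open>The image of \<open>E\<close> under \<open>T\<close> is contained in \<open>E\<close>, closed because finite-dimensional, and dense in the
  range because \<open>E\<close> is dense; so it is the whole range.\<close>

lemma finite_rank_range_in_E:
  assumes "T \<in> finite_rank_part (rep_algebra quat_group E \<pi>)"
  shows "blinfun_apply T x \<in> E"
proof -
  have T: "T \<in> rep_algebra quat_group E \<pi>" "finite_rank_op T"
    using assms by (auto simp: finite_rank_part_def)
  let ?V = "blinfun_apply T ` E"
  have "subspace ?V"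
    using subspace_E by (intro linear_subspace_image bounded_linear.linear[OF blinfun.bounded_linear_right])
  moreover have "finite_dimensional_set ?V"
    using T(2) unfolding finite_rank_op_def finite_dimensional_set_def by blast
  ultimately have "closed ?V"
    by (rule closed_finite_dimensional_subspace)
  have "blinfun_apply T ` closure E \<subseteq> closure ?V"
    by (intro image_closure_subset[OF _ _ closure_subset] blinfun.continuous_on continuous_on_const continuous_on_id closed_closure)
  then have "blinfun_apply T x \<in> ?V"
    using \<open>closed ?V\<close> dense_E by auto
  then show ?thesis
    using T(1) by (auto simp: rep_algebra_def)
qed

lemma finite_rank_space_rep_algebra:
  assumes "quat_functional \<Phi>" "e \<in> E" "\<Phi> e = 1"
  shows "finite_rank_space (rep_algebra quat_group E \<pi>) = E"
proof
  show "finite_rank_space (rep_algebra quat_group E \<pi>) \<subseteq> E"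
    unfolding finite_rank_space_def
    by (intro span_minimal subspace_E) (auto simp: finite_rank_range_in_E)
  show "E \<subseteq> finite_rank_space (rep_algebra quat_group E \<pi>)"
  proof
    fix y assume "y \<in> E"
    obtain T where T: "T \<in> rep_algebra quat_group E \<pi>" "finite_rank_op T" "compact_op T"
      "blinfun_apply T = (\<lambda>x. act (\<Phi> x) y)"
      by (rule quaternionic_rank_one_operator[OF assms(1) \<open>y \<in> E\<close>])
    have "y = blinfun_apply T e"
      using assms(3) by (simp add: T(4) act_one)
    with T(1,2) show "y \<in> finite_rank_space (rep_algebra quat_group E \<pi>)"
      unfolding finite_rank_space_def finite_rank_part_def by (blast intro: span_base)
  qed
qed

text \<open>
  Operators in the algebra are quaternion-linear on \<open>E\<close>, so every quaternion acts as an element of the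
  commutant. Conversely, let \<open>S\<close> commute with \<open>T x = \<Phi> x \<cdot> y\<close>. As \<open>T e = y\<close>, one gets \<open>S y = T (S e) = \<Phi> (S e) \<cdot> y\<close>, where the quaternion \<open>\<Phi> (S e)\<close> does not
  depend on \<open>y\<close>.
\<close>

lemma commutant_rep_algebra:
  assumes \<Phi>: "quat_functional \<Phi>" and e: "e \<in> E" "\<Phi> e = 1"
  shows "commutant_algebra (rep_algebra quat_group E \<pi>) = range (\<lambda>q. restrict (act q) E)"
proof (intro equalityI subsetI)
  let ?A = "rep_algebra quat_group E \<pi>"
  note space = finite_rank_space_rep_algebra[OF assms]
  fix S assume "S \<in> commutant_algebra ?A"
  then have S: "S \<in> extensional E" "\<And>x. x \<in> E \<Longrightarrow> S x \<in> E"
    "\<And>T x. T \<in> finite_rank_part ?A \<Longrightarrow> x \<in> E \<Longrightarrow> S (blinfun_apply T x) = blinfun_apply T (S x)"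
    by (auto simp: commutant_algebra_def linear_map_on_def space)
  have "S y = act (\<Phi> (S e)) y" if y: "y \<in> E" for y
  proof -
    obtain T where "T \<in> ?A" "finite_rank_op T" "compact_op T"
      and T: "blinfun_apply T = (\<lambda>x. act (\<Phi> x) y)"
      by (rule quaternionic_rank_one_operator[OF \<Phi> y])
    then have "T \<in> finite_rank_part ?A"
      by (simp add: finite_rank_part_def)
    from S(3)[OF this e(1)] show ?thesis
      by (simp add: T e(2) act_one)
  qed
  then have "S = restrict (act (\<Phi> (S e))) E"
    using S(1) by (intro extensionalityI[of _ E]) auto
  then show "S \<in> range (\<lambda>q. restrict (act q) E)"
    by blast
next
  let ?A = "rep_algebra quat_group E \<pi>"
  note space = finite_rank_space_rep_algebra[OF assms]
  fix S assume "S \<in> range (\<lambda>q. restrict (act q) E)"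
  then obtain q where S: "S = restrict (act q) E"
    by blast
  have "linear_map_on E E S"
    using act_linear[of q] by (auto simp: S linear_map_on_def subspace_add subspace_scale subspace_E)
  then show "S \<in> commutant_algebra ?A"
    unfolding commutant_algebra_def space
    by (auto simp: S finite_rank_range_in_E finite_rank_part_def blinfun_commutes_act)
qed

lemma act_faithful:
  assumes "x \<in> E" "x \<noteq> 0" "act p x = act q x"
  shows "p = q"
proof (rule ccontr)
  assume "p \<noteq> q"
  then have "p + - q \<noteq> 0"
    by simp
  then obtain r where r: "r * (p + - q) = 1"
    by (rule quat_inverse)
  have "act (p + - q) x = 0"
    using act_add[of p "- q" x] act_scaleR[of "- 1" q x] assms(3) by simp
  then have "act r 0 = x"
    using act_mult[OF \<open>x \<in> E\<close>, of r "p + - q"] r by (simp add: act_one)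
  moreover have "act r 0 = 0"
    using act_linear[of r] subspace_0[OF subspace_E] unfolding linear_map_on_def
    by (metis scaleR_zero_left)
  ultimately show False
    using \<open>x \<noteq> 0\<close> by simp
qed

end

theorem theorem4p5:
  fixes E :: "'a::banach set"
    and \<pi> :: "quat \<Rightarrow> 'a \<Rightarrow> 'a"
  assumes "\<not> finite_dimensional_set (UNIV :: 'a set)"
    and "representation_on quat_group E \<pi>"
    and "\<forall>x\<in>E. \<pi> 1 x = x \<and> - \<pi> (-1) x = x"
    and "closed_representation quat_group E \<pi>"
    and "regular_representation quat_group E \<pi>"
  shows "Lomonosov_algebra (rep_algebra quat_group E \<pi>) \<and>
         quaternion_type (rep_algebra quat_group E \<pi>)"
proof -
  interpret quaternionic_representation E \<pi>
    by unfold_locales (use assms(2,3) in \<open>auto simp: minus_equation_iff\<close>)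
  let ?A = "rep_algebra quat_group E \<pi>"
  obtain m where m: "m \<in> E" "m \<noteq> 0"
    using E_nonzero[OF assms(1)] .
  obtain \<Phi> e where e: "quat_functional \<Phi>" "e \<in> E" "\<Phi> e = 1"
    using normalized_functional[OF assms(5) m] .
  obtain T where T: "T \<in> ?A" "finite_rank_op T" "compact_op T"
    "blinfun_apply T = (\<lambda>x. act (\<Phi> x) m)"
    by (rule quaternionic_rank_one_operator[OF e(1) m(1)])
  have "T \<noteq> 0"
    using m(2) e(3) fun_cong[OF T(4), of e] by (auto simp: act_one)
  have "bij_betw (\<lambda>q. restrict (act q) E) UNIV (commutant_algebra ?A)"
    unfolding commutant_rep_algebra[OF e] bij_betw_def
    using act_faithful[OF m] m(1) by (auto intro!: injI dest: fun_cong[where x = m])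
  then have "quaternion_type ?A"
    unfolding quaternion_type_def L_algebra_def finite_rank_space_rep_algebra[OF e]
    using rep_algebra_transitive[OF assms(5)] T \<open>T \<noteq> 0\<close>
    by (intro conjI exI[where x = "\<lambda>q. restrict (act q) E"])
       (auto simp: act_add act_scaleR act_mult act_one act_in)
  moreover have "Lomonosov_algebra ?A"
    unfolding Lomonosov_algebra_def
    using rep_algebra_transitive[OF assms(5)] rep_algebra_SOT_closed[OF assms(4)] T \<open>T \<noteq> 0\<close> by blast
  ultimately show ?thesis
    by blast
qed

end
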